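(* Let $s$ and $s^*$ be a (suitably scaled) spacelike S$_1$-cmc pair in $\mathbb{R}^{2,1}$ with sphere centers $c,c^*$. Then the Gauss map $n:V(\mathcal G)\to\mathbb{R}^{2,1}$, $n_v:=c^*_v-c_v$, is a spacelike two-sphere Koebe net. Furthermore, the pair $(s,n)$ has constant discrete mean curvature $H=1$.
   Context: Combinatorics: $\mathcal G$ is a quad graph (cell decomposition of a surface with quadrilateral faces) with interior vertices of even valence, edges divided into "horizontal" and "vertical", alternating around each face. The vertices of a face are $v,v_i,v_{ij},v_j$ with $(v,v_i),(v_j,v_{ij})$ horizontal, $(v,v_j),(v_i,v_{ij})$ vertical. $\mathbb{R}^{2,1}$ carries $\langle x,y\rangle=x_1y_1+x_2y_2-x_3y_3$; write $\|x\|^2=\langle x,x\rangle$. A vector is timelike if $\langle x,x\rangle<0$; a plane is spacelike if the induced form is positive definite. The sphere with center $c$ and squared radius $d^2$ is $\{x:\langle x-c,x-c\rangle=d^2\}$; it is timelike if $d^2>0$, spacelike if $d^2<0$. Two timelike spheres touch if they share a point at which they have the same tangent plane. Lift: $\mathbb{R}^{3,2}$ carries $\langle x,y\rangle_{3,2}=x_1y_1+x_2y_2+x_3y_3-x_4y_4-x_5y_5$; $e_0=\frac12(e_5-e_3)$, $e_\infty=\frac12(e_3+e_5)$; $x\in\mathbb{R}^{2,1}$ is identified with $x_1e_1+x_2e_2+x_3e_4$. An oriented timelike sphere with center $c$ and signed radius $d\ne0$ is lifted to $\hat s=\frac1d(c+e_0+(\|c\|^2-d^2)e_\infty)$. Spacelike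 S-isothermic surface: a map $s$ from $V(\mathcal G)$ to oriented timelike spheres such that the four centers of each face lie in a spacelike plane and $\hat s_{v_{ij}}-\hat s_v=a_{ij}(\hat s_{v_j}-\hat s_{v_i})$ on each face for some $a_{ij}\in\mathbb{R}$. It is S$_1$-isothermic if neighboring spheres touch; orientations are chosen so that $\langle\hat s_v,\hat s_{v'}\rangle_{3,2}=-1$ on horizontal and $+1$ on vertical edges. Christoffel dual $s^*$: $c^*_{v'}-c^*_v=\lambda\frac{c_{v'}-c_v}{d_vd_{v'}}$, $d_v^*=\lambda/d_v$, $\lambda>0$ a global constant; defined up to translation. Timelike Darboux pair: S-isothermic $s,s^+$ such that for each edge $(v,v')$, $\hat s^+_{v'}-\hat s_v=a_+(\hat s^+_v-\hat s_{v'})$ with some $a_+\in\mathbb{R}$ (possibly after reversing simultaneously the orientation of all spheres of $s^+$) and the vectors $c^+_v-c_v$ are timelike. Spacelike S$_1$-cmc pair: a spacelike S$_1$-isothermic surface $s$ and its (appropriately scaled and translated) Christoffel dual $s^*$ that form a timelike Darboux pair. Spacelike two-sphere Koebe net: a net $k:V(\mathcal G)\to\mathbb{R}^{2,1}$ with planar faces whose edges (lines through neighboring vertices, assumed distinct) alternately touch two spacelike spheres $S^2_+,S^2_-$ centered at the origin (one touched by horizontal edges, the other by vertical edges), whose squared radii (negative numbers) satisfy $r_+^2r_-^2=1$. "Suitably scaled" means multiplied by a common factor so that this normalization holds. Discrete mean curvature of $(s,n)$: for each face $f$, $H_f=-\frac{A(c(f),n(f))}{A(c(f))}$, where $c(f),n(f)$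 are the corresponding planar quadrilaterals with parallel edges, $A$ is the area in the spacelike face plane (direction) and $A(P,Q)=\frac12(A(P+Q)-A(P)-A(Q))$ is the mixed area. *)

theory Defs
  imports "HOL-Analysis.Analysis"
begin

section \<open>Quad graphs\<close>

text \<open>
  A cell decomposition of a surface (possibly with boundary) into quadrilaterals, given by its
  incidences.  The corners \<open>corner G f k\<close>, \<open>k = 0, 1, 2, 3\<close>, of a face are
  \<open>v, v\<^sub>i, v\<^sub>i\<^sub>j, v\<^sub>j\<close>, and \<open>side G f k\<close> joins the corners \<open>k\<close> and \<open>k + 1\<close> (mod 4), so that the
  sides 0 and 2 are horizontal and the sides 1 and 3 are vertical.  Several edges may
  have the same end points, and the graph may be infinite.
\<close>

record ('v, 'e, 'f) quad_graph_data =
  verts :: "'v set"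
  edges :: "'e set"
  faces :: "'f set"
  ends :: "'e \<Rightarrow> 'v set"
  horizontal :: "'e set"
  corner :: "'f \<Rightarrow> nat \<Rightarrow> 'v"
  side :: "'f \<Rightarrow> nat \<Rightarrow> 'e"

definition hor_adjacent :: "('v, 'e, 'f) quad_graph_data \<Rightarrow> 'v \<Rightarrow> 'v \<Rightarrow> bool" where
  "hor_adjacent G v w \<longleftrightarrow> (\<exists>e \<in> edges G. e \<in> horizontal G \<and> ends G e = {v, w})"

definition ver_adjacent :: "('v, 'e, 'f) quad_graph_data \<Rightarrow> 'v \<Rightarrow> 'v \<Rightarrow> bool" where
  "ver_adjacent G v w \<longleftrightarrow> (\<exists>e \<in> edges G. e \<notin> horizontal G \<and> ends G e = {v, w})"

definition adjacent :: "('v, 'e, 'f) quad_graph_data \<Rightarrow> 'v \<Rightarrow> 'v \<Rightarrow> bool" where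
  "adjacent G v w \<longleftrightarrow> (\<exists>e \<in> edges G. ends G e = {v, w})"

definition incident_edges :: "('v, 'e, 'f) quad_graph_data \<Rightarrow> 'v \<Rightarrow> 'e set" where
  "incident_edges G v = {e \<in> edges G. v \<in> ends G e}"

definition face_sides_at :: "('v, 'e, 'f) quad_graph_data \<Rightarrow> 'e \<Rightarrow> ('f \<times> nat) set" where
  "face_sides_at G e = {(f, k). f \<in> faces G \<and> k < 4 \<and> side G f k = e}"

text \<open>Two edges are linked at \<open>v\<close> if they are consecutive sides of a face with corner \<open>v\<close> between them.\<close>

definition linked_at :: "('v, 'e, 'f) quad_graph_data \<Rightarrow> 'v \<Rightarrow> 'e \<Rightarrow> 'e \<Rightarrow> bool" where
  "linked_at G v e e' \<longleftrightarrow>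
     (\<exists>f \<in> faces G. \<exists>k < 4. corner G f ((k + 1) mod 4) = v \<and>
        {e, e'} = {side G f k, side G f ((k + 1) mod 4)})"

definition interior_vertex :: "('v, 'e, 'f) quad_graph_data \<Rightarrow> 'v \<Rightarrow> bool" where
  "interior_vertex G v \<longleftrightarrow> v \<in> verts G \<and> (\<forall>e \<in> incident_edges G v. card (face_sides_at G e) = 2)"

text \<open>
  The conditions on \<open>face_sides_at\<close> and \<open>linked_at\<close> say that the squares are glued to a surface:
  an edge borders one square (boundary) or two, and the link of every vertex is a finite path or
  cycle.  The last condition is connectedness of the surface.
\<close>

definition quad_graph :: "('v, 'e, 'f) quad_graph_data \<Rightarrow> bool" where
  "quad_graph G \<longleftrightarrow>
     horizontal G \<subseteq> edges G \<and>
     (\<forall>e \<in> edges G. ends G e \<subseteq> verts G \<and> card (ends G e) = 2 \<and>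
        card (face_sides_at G e) \<in> {1, 2}) \<and>
     (\<forall>f \<in> faces G. \<forall>k < 4.
        corner G f k \<in> verts G \<and> side G f k \<in> edges G \<and>
        ends G (side G f k) = {corner G f k, corner G f ((k + 1) mod 4)} \<and>
        (side G f k \<in> horizontal G \<longleftrightarrow> even k)) \<and>
     (\<forall>v \<in> verts G.
        finite (incident_edges G v) \<and> incident_edges G v \<noteq> {} \<and>
        (\<forall>e \<in> incident_edges G v. \<forall>e' \<in> incident_edges G v. (linked_at G v)\<^sup>*\<^sup>* e e')) \<and>
     (\<forall>v. interior_vertex G v \<longrightarrow> even (card (incident_edges G v))) \<and>
     (\<forall>v \<in> verts G. \<forall>w \<in> verts G. (adjacent G)\<^sup>*\<^sup>* v w)"


section \<open>Minkowski space and its spheres\<close>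

definition mink :: "real ^ 3 \<Rightarrow> real ^ 3 \<Rightarrow> real" where
  "mink x y = x $ 1 * y $ 1 + x $ 2 * y $ 2 - x $ 3 * y $ 3"

definition timelike :: "real ^ 3 \<Rightarrow> bool" where
  "timelike x \<longleftrightarrow> mink x x < 0"

definition spacelike_plane :: "(real ^ 3) set \<Rightarrow> bool" where
  "spacelike_plane P \<longleftrightarrow>
     affine P \<and> aff_dim P = 2 \<and> (\<forall>x \<in> P. \<forall>y \<in> P. x \<noteq> y \<longrightarrow> mink (y - x) (y - x) > 0)"

text \<open>Center \<open>c\<close> and \<^emph>\<open>squared\<close> radius \<open>q\<close>; the sphere is timelike if \<open>q > 0\<close>, spacelike if \<open>q < 0\<close>.\<close>

definition mink_sphere :: "real ^ 3 \<Rightarrow> real \<Rightarrow> (real ^ 3) set" where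
  "mink_sphere c q = {x. mink (x - c) (x - c) = q}"

definition tangent_plane :: "real ^ 3 \<Rightarrow> real ^ 3 \<Rightarrow> (real ^ 3) set" where
  "tangent_plane c x = {y. mink (x - c) (y - x) = 0}"

definition line_through :: "real ^ 3 \<Rightarrow> real ^ 3 \<Rightarrow> (real ^ 3) set" where
  "line_through x y = affine hull {x, y}"

definition line_touches_sphere :: "(real ^ 3) set \<Rightarrow> real ^ 3 \<Rightarrow> real \<Rightarrow> bool" where
  "line_touches_sphere L c q \<longleftrightarrow> (\<exists>x \<in> L \<inter> mink_sphere c q. L \<subseteq> tangent_plane c x)"

text \<open>An oriented timelike sphere is the pair of its center and its signed radius \<open>d \<noteq> 0\<close>.\<close>

type_synonym osphere = "(real ^ 3) \<times> real"

abbreviation center :: "osphere \<Rightarrow> real ^ 3" where "center \<equiv> fst"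
abbreviation radius :: "osphere \<Rightarrow> real" where "radius \<equiv> snd"

definition reverse_orientation :: "osphere \<Rightarrow> osphere" where
  "reverse_orientation S = (center S, - radius S)"

definition scale_sphere :: "real \<Rightarrow> osphere \<Rightarrow> osphere" where
  "scale_sphere \<mu> S = (\<mu> *\<^sub>R center S, \<mu> * radius S)"

definition spheres_touch :: "osphere \<Rightarrow> osphere \<Rightarrow> bool" where
  "spheres_touch S T \<longleftrightarrow>
     (\<exists>x \<in> mink_sphere (center S) ((radius S)\<^sup>2) \<inter> mink_sphere (center T) ((radius T)\<^sup>2).
        tangent_plane (center S) x = tangent_plane (center T) x)"


section \<open>The lift to signature (3,2)\<close>

definition inner32 :: "real ^ 5 \<Rightarrow> real ^ 5 \<Rightarrow> real" where
  "inner32 x y = x $ 1 * y $ 1 + x $ 2 * y $ 2 + x $ 3 * y $ 3 - x $ 4 * y $ 4 - x $ 5 * y $ 5"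

definition e_zero :: "real ^ 5" where
  "e_zero = (1/2) *\<^sub>R (axis 5 1 - axis 3 1)"

definition e_inf :: "real ^ 5" where
  "e_inf = (1/2) *\<^sub>R (axis 3 1 + axis 5 1)"

definition embed :: "real ^ 3 \<Rightarrow> real ^ 5" where
  "embed x = x $ 1 *\<^sub>R axis 1 1 + x $ 2 *\<^sub>R axis 2 1 + x $ 3 *\<^sub>R axis 4 1"

definition lift :: "osphere \<Rightarrow> real ^ 5" where
  "lift S = (1 / radius S) *\<^sub>R
     (embed (center S) + e_zero + (mink (center S) (center S) - (radius S)\<^sup>2) *\<^sub>R e_inf)"


section \<open>S-isothermic surfaces and their transformations\<close>

definition S_isothermic :: "('v, 'e, 'f) quad_graph_data \<Rightarrow> ('v \<Rightarrow> osphere) \<Rightarrow> bool" where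
  "S_isothermic G s \<longleftrightarrow>
     (\<forall>v \<in> verts G. radius (s v) \<noteq> 0) \<and>
     (\<forall>f \<in> faces G.
        (\<exists>P. spacelike_plane P \<and> (\<forall>k < 4. center (s (corner G f k)) \<in> P)) \<and>
        (\<exists>a. lift (s (corner G f 2)) - lift (s (corner G f 0)) =
             a *\<^sub>R (lift (s (corner G f 3)) - lift (s (corner G f 1)))))"

definition S1_isothermic :: "('v, 'e, 'f) quad_graph_data \<Rightarrow> ('v \<Rightarrow> osphere) \<Rightarrow> bool" where
  "S1_isothermic G s \<longleftrightarrow>
     S_isothermic G s \<and>
     (\<forall>v w. adjacent G v w \<longrightarrow> spheres_touch (s v) (s w)) \<and>
     (\<forall>v w. hor_adjacent G v w \<longrightarrow> inner32 (lift (s v)) (lift (s w)) = - 1) \<and>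
     (\<forall>v w. ver_adjacent G v w \<longrightarrow> inner32 (lift (s v)) (lift (s w)) = 1)"

definition christoffel_dual ::
  "('v, 'e, 'f) quad_graph_data \<Rightarrow> ('v \<Rightarrow> osphere) \<Rightarrow> ('v \<Rightarrow> osphere) \<Rightarrow> bool" where
  "christoffel_dual G s s' \<longleftrightarrow>
     (\<exists>l > 0.
        (\<forall>v \<in> verts G. radius (s' v) = l / radius (s v)) \<and>
        (\<forall>v w. adjacent G v w \<longrightarrow>
           center (s' w) - center (s' v) =
             (l / (radius (s v) * radius (s w))) *\<^sub>R (center (s w) - center (s v))))"

definition darboux_edges ::
  "('v, 'e, 'f) quad_graph_data \<Rightarrow> ('v \<Rightarrow> osphere) \<Rightarrow> ('v \<Rightarrow> osphere) \<Rightarrow> bool" where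
  "darboux_edges G s s' \<longleftrightarrow>
     (\<forall>v w. adjacent G v w \<longrightarrow>
        (\<exists>a. lift (s' w) - lift (s v) = a *\<^sub>R (lift (s' v) - lift (s w))))"

definition timelike_darboux_pair ::
  "('v, 'e, 'f) quad_graph_data \<Rightarrow> ('v \<Rightarrow> osphere) \<Rightarrow> ('v \<Rightarrow> osphere) \<Rightarrow> bool" where
  "timelike_darboux_pair G s s' \<longleftrightarrow>
     S_isothermic G s \<and> S_isothermic G s' \<and>
     (darboux_edges G s s' \<or> darboux_edges G s (reverse_orientation \<circ> s')) \<and>
     (\<forall>v \<in> verts G. timelike (center (s' v) - center (s v)))"

definition S1_cmc_pair ::
  "('v, 'e, 'f) quad_graph_data \<Rightarrow> ('v \<Rightarrow> osphere) \<Rightarrow> ('v \<Rightarrow> osphere) \<Rightarrow> bool" where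
  "S1_cmc_pair G s s' \<longleftrightarrow>
     S1_isothermic G s \<and> christoffel_dual G s s' \<and> timelike_darboux_pair G s s'"

definition gauss_map :: "('v \<Rightarrow> osphere) \<Rightarrow> ('v \<Rightarrow> osphere) \<Rightarrow> 'v \<Rightarrow> real ^ 3" where
  "gauss_map s s' v = center (s' v) - center (s v)"


section \<open>Two-sphere Koebe nets\<close>

definition neighbours_distinct :: "('v, 'e, 'f) quad_graph_data \<Rightarrow> ('v \<Rightarrow> real ^ 3) \<Rightarrow> bool" where
  "neighbours_distinct G k \<longleftrightarrow> (\<forall>v w. adjacent G v w \<longrightarrow> k v \<noteq> k w)"

text \<open>\<open>p\<close> and \<open>q\<close> are the squared radii of the two spheres.\<close>

definition spacelike_two_sphere_koebe ::
  "('v, 'e, 'f) quad_graph_data \<Rightarrow> ('v \<Rightarrow> real ^ 3) \<Rightarrow> bool" where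
  "spacelike_two_sphere_koebe G k \<longleftrightarrow>
     neighbours_distinct G k \<and>
     (\<forall>f \<in> faces G. coplanar (k ` corner G f ` {..<4})) \<and>
     (\<exists>p q. p < 0 \<and> q < 0 \<and> p * q = 1 \<and>
        (\<forall>v w. hor_adjacent G v w \<longrightarrow> line_touches_sphere (line_through (k v) (k w)) 0 p) \<and>
        (\<forall>v w. ver_adjacent G v w \<longrightarrow> line_touches_sphere (line_through (k v) (k w)) 0 q))"


section \<open>Discrete mean curvature\<close>

text \<open>A quadrilateral is given by its corners \<open>P 0, P 1, P 2, P 3\<close>; an orthonormal frame of its
  spacelike plane fixes an orientation.\<close>

definition quad_frame :: "(nat \<Rightarrow> real ^ 3) \<Rightarrow> real ^ 3 \<Rightarrow> real ^ 3 \<Rightarrow> bool" where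
  "quad_frame P u w \<longleftrightarrow>
     mink u u = 1 \<and> mink w w = 1 \<and> mink u w = 0 \<and> (\<forall>k < 4. P k - P 0 \<in> span {u, w})"

text \<open>Oriented area, by the shoelace formula in the coordinates of the frame.\<close>

definition quad_area :: "real ^ 3 \<Rightarrow> real ^ 3 \<Rightarrow> (nat \<Rightarrow> real ^ 3) \<Rightarrow> real" where
  "quad_area u w P =
     (1/2) * (\<Sum>k<4. mink u (P k) * mink w (P ((k + 1) mod 4))
                    - mink u (P ((k + 1) mod 4)) * mink w (P k))"

definition mixed_area ::
  "real ^ 3 \<Rightarrow> real ^ 3 \<Rightarrow> (nat \<Rightarrow> real ^ 3) \<Rightarrow> (nat \<Rightarrow> real ^ 3) \<Rightarrow> real" where
  "mixed_area u w P Q =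
     (1/2) * (quad_area u w (\<lambda>k. P k + Q k) - quad_area u w P - quad_area u w Q)"

definition quad_mean_curvature ::
  "real ^ 3 \<Rightarrow> real ^ 3 \<Rightarrow> (nat \<Rightarrow> real ^ 3) \<Rightarrow> (nat \<Rightarrow> real ^ 3) \<Rightarrow> real" where
  "quad_mean_curvature u w P Q = - mixed_area u w P Q / quad_area u w P"

definition parallel_edges :: "(nat \<Rightarrow> real ^ 3) \<Rightarrow> (nat \<Rightarrow> real ^ 3) \<Rightarrow> bool" where
  "parallel_edges P Q \<longleftrightarrow>
     (\<forall>k < 4. Q ((k + 1) mod 4) - Q k \<in> span {P ((k + 1) mod 4) - P k})"

text \<open>
  The mean curvature of a face does not depend on the frame, since reversing the orientation changes
  the sign of both areas.  It is defined only where the area of the face does not vanish.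
\<close>

definition constant_mean_curvature ::
  "('v, 'e, 'f) quad_graph_data \<Rightarrow> ('v \<Rightarrow> osphere) \<Rightarrow> ('v \<Rightarrow> real ^ 3) \<Rightarrow> real \<Rightarrow> bool" where
  "constant_mean_curvature G s n H \<longleftrightarrow>
     (\<forall>f \<in> faces G.
        let P = (\<lambda>k. center (s (corner G f k))); Q = (\<lambda>k. n (corner G f k)) in
        parallel_edges P Q \<and> (\<exists>u w. quad_frame P u w) \<and>
        (\<forall>u w. quad_frame P u w \<and> quad_area u w P \<noteq> 0 \<longrightarrow> quad_mean_curvature u w P Q = H))"

end

theory Submission
  imports Defs
begin

text \<open>
  On an edge with \<open>u = c' - c\<close> and \<open>n' - n = (l / (d d') - 1) u\<close>, the Darboux condition (with the
  orientation of the dual reversed) amounts to \<open>\<langle>u, n + n'\<rangle> = (d\<^sup>2 - d'\<^sup>2) (1 + l / (d d'))\<close>.  Hence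
  \<open>K = \<langle>n, n\<rangle> - d\<^sup>2 - l\<^sup>2 / d\<^sup>2\<close> is the same at all vertices, and as \<open>\<langle>u, u\<rangle>\<close> is \<open>(d + d')\<^sup>2\<close> or
  \<open>(d - d')\<^sup>2\<close>, the squared distance of the line through \<open>n, n'\<close> from the origin is \<open>K + 2 l\<close> on
  horizontal and \<open>K - 2 l\<close> on vertical edges; both are negative because \<open>n\<close> is timelike and \<open>u\<close>
  spacelike.  Without reversal the Darboux condition forces \<open>n = n'\<close> on every edge.
  For the curvature, opposite diagonals of a face and its Christoffel dual are parallel, so
  \<open>A(c, c*) = 0\<close> and \<open>A(c, n) = - A(c)\<close>, whatever the scaling.
\<close>

section \<open>The Minkowski form and the lift\<close>

lemma mink_bilinear [simp]:
  "mink (x + y) z = mink x z + mink y z" "mink z (x + y) = mink z x + mink z y"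
  "mink (x - y) z = mink x z - mink y z" "mink z (x - y) = mink z x - mink z y"
  "mink (r *\<^sub>R x) z = r * mink x z" "mink z (r *\<^sub>R x) = r * mink z x"
  "mink 0 z = 0" "mink z 0 = 0"
  by (simp_all add: mink_def algebra_simps)

lemma mink_commute: "mink x y = mink y x"
  by (simp add: mink_def mult.commute)

text \<open>Coordinates 3 and 5 mix the coefficients of \<open>e_zero\<close> and
  \<open>e_inf\<close>. The case \<open>d = 0\<close> is included, since both sides then vanish by
  the convention on division by zero; later component comparisons thus carry no side
  conditions.\<close>

lemma lift_nth:
  "lift (c, d) $ 1 = c $ 1 / d" "lift (c, d) $ 2 = c $ 2 / d" "lift (c, d) $ 4 = c $ 3 / d"
  "lift (c, d) $ 3 = (mink c c - d\<^sup>2 - 1) / (2 * d)"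
  "lift (c, d) $ 5 = (mink c c - d\<^sup>2 + 1) / (2 * d)"
  by (cases "d = 0"; simp add: lift_def embed_def e_zero_def e_inf_def axis_def field_simps)+

text \<open>\<open>e_zero\<close> and \<open>e_inf\<close> are null with product -1/2, which turns
  the product of two lifts into a polarized distance. The values -1 and 1 mean that the squared
  distance of the centers is (d + d')^2 and (d - d')^2 respectively.\<close>

lemma inner32_lift:
  assumes "d \<noteq> 0" "d' \<noteq> 0"
  shows "inner32 (lift (c, d)) (lift (c', d')) =
    (d\<^sup>2 + d'\<^sup>2 - mink (c' - c) (c' - c)) / (2 * d * d')"
  using assms unfolding inner32_def lift_nth
  by (simp add: mink_def field_simps power2_eq_square)

text \<open>Comparison of the components along \<open>e_zero\<close>, Minkowski space and
  \<open>e_inf\<close>, in this order. The null coefficients are recovered as the difference and the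
  sum of coordinates 5 and 3.\<close>

lemma lift_diff_proportional:
  assumes "lift (c1, d1) - lift (c2, d2) = a *\<^sub>R (lift (c3, d3) - lift (c4, d4))"
  shows "1 / d1 - 1 / d2 = a * (1 / d3 - 1 / d4)"
    and "(1 / d1) *\<^sub>R c1 - (1 / d2) *\<^sub>R c2 = a *\<^sub>R ((1 / d3) *\<^sub>R c3 - (1 / d4) *\<^sub>R c4)"
    and "(mink c1 c1 - d1\<^sup>2) / d1 - (mink c2 c2 - d2\<^sup>2) / d2 =
      a * ((mink c3 c3 - d3\<^sup>2) / d3 - (mink c4 c4 - d4\<^sup>2) / d4)"
proof -
  have comp: "lift (c1, d1) $ i - lift (c2, d2) $ i = a * (lift (c3, d3) $ i - lift (c4, d4) $ i)" for i
    using assms by (metis vector_minus_component vector_scaleR_component real_scaleR_def)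
  have e0: "1 / d = lift (c, d) $ 5 - lift (c, d) $ 3" for c d
    by (simp add: lift_nth diff_divide_distrib add_divide_distrib)
  have einf: "(mink c c - d\<^sup>2) / d = lift (c, d) $ 5 + lift (c, d) $ 3" for c d
    by (simp add: lift_nth diff_divide_distrib add_divide_distrib)
  show "1 / d1 - 1 / d2 = a * (1 / d3 - 1 / d4)"
    using comp[of 5] comp[of 3] unfolding e0[of d1 c1] e0[of d2 c2] e0[of d3 c3] e0[of d4 c4]
    by (simp add: algebra_simps)
  show "(mink c1 c1 - d1\<^sup>2) / d1 - (mink c2 c2 - d2\<^sup>2) / d2 =
      a * ((mink c3 c3 - d3\<^sup>2) / d3 - (mink c4 c4 - d4\<^sup>2) / d4)"
    using comp[of 5] comp[of 3] unfolding einf by (simp add: algebra_simps)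
  show "(1 / d1) *\<^sub>R c1 - (1 / d2) *\<^sub>R c2 = a *\<^sub>R ((1 / d3) *\<^sub>R c3 - (1 / d4) *\<^sub>R c4)"
    using comp[of 1] comp[of 2] comp[of 4] by (simp add: vec_eq_iff forall_3 lift_nth)
qed

section \<open>One edge of an \<open>S\<^sub>1\<close>-cmc pair\<close>

text \<open>If d d' = l, the dual edge equals the original one. Otherwise the \<open>e_zero\<close>
  component forces a = d'/d, and the Minkowski component then says that c' - c is its own negative.
  The Gauss map is constant along the edge either way.\<close>

lemma darboux_edge_degenerate:
  assumes nz: "d \<noteq> 0" "d' \<noteq> 0" "l > 0"
    and dual: "cs' - cs = (l / (d * d')) *\<^sub>R (c' - c)"
    and darboux: "lift (cs', l / d') - lift (c, d) = a *\<^sub>R (lift (cs, l / d) - lift (c', d'))"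
  shows "cs' - c' = cs - c"
proof (cases "d * d' = l")
  case True
  with nz dual have "cs' - cs = c' - c" by simp
  then show ?thesis by (simp add: algebra_simps)
next
  case False
  have "d' / l - 1 / d = a * (d / l - 1 / d')"
    using lift_diff_proportional(1)[OF darboux] nz by simp
  then have "l * (d' * (d * d' - l)) = l * (a * d * (d * d' - l))"
    using nz by (simp add: field_simps)
  with False nz(3) have "d' = a * d" by simp
  then have a: "a = d' / d" using nz by (simp add: field_simps)
  have cs': "cs' = cs + (l / (d * d')) *\<^sub>R (c' - c)" using dual by (simp add: algebra_simps)
  have "(d' / l) *\<^sub>R cs' - (1 / d) *\<^sub>R c = a *\<^sub>R ((d / l) *\<^sub>R cs - (1 / d') *\<^sub>R c')"
    using lift_diff_proportional(2)[OF darboux] by simp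
  then have "(1 / d) *\<^sub>R (c' - c) = - ((1 / d) *\<^sub>R (c' - c))"
    unfolding cs' a using nz by (simp add: vec_eq_iff field_simps)
  then have "c' = c" using nz by (simp add: vec_eq_iff)
  with cs' show ?thesis by simp
qed

text \<open>Once a = d'/d is known, the \<open>e_inf\<close> component relates the increments of the
  squared norms of the two centers along the edge. Writing both edges as multiples of u makes this
  relation linear in the products of u with \<open>cs\<close> and \<open>c\<close>.\<close>

lemma darboux_edge_inner:
  assumes nz: "d \<noteq> 0" "d' \<noteq> 0" "l > 0"
    and dual: "cs' - cs = (l / (d * d')) *\<^sub>R (c' - c)"
    and darboux: "lift (cs', - (l / d')) - lift (c, d) = a *\<^sub>R (lift (cs, - (l / d)) - lift (c', d'))"
    and nonneg: "mink (c' - c) (c' - c) \<ge> 0"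
    and timelike: "mink (cs - c) (cs - c) < 0"
  shows "mink (c' - c) ((cs' - c') + (cs - c)) = (d\<^sup>2 - d'\<^sup>2) * (1 + l / (d * d'))"
proof -
  define u where "u = c' - c"
  have c': "c' = c + u" by (simp add: u_def)
  have cs': "cs' = cs + (l / (d * d')) *\<^sub>R u" using dual by (simp add: u_def algebra_simps)
  have r0: "- (d' / l) - 1 / d = a * (- (d / l) - 1 / d')"
    using lift_diff_proportional(1)[OF darboux] by simp
  have r1: "- ((d' / l) *\<^sub>R cs') - (1 / d) *\<^sub>R c = a *\<^sub>R (- ((d / l) *\<^sub>R cs) - (1 / d') *\<^sub>R c')"
    using lift_diff_proportional(2)[OF darboux] by simp
  have r2: "- (d' / l * (mink cs' cs' - (l / d')\<^sup>2)) - (mink c c - d\<^sup>2) / d =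
      a * (- (d / l * (mink cs cs - (l / d)\<^sup>2)) - (mink c' c' - d'\<^sup>2) / d')"
    using lift_diff_proportional(3)[OF darboux] by (simp add: mult.commute)
  have a: "a = d' / d"
  proof (cases "d * d' = - l")
    case False
    have "l * (d' * (d * d' + l)) = l * (a * d * (d * d' + l))"
      using r0 nz by (simp add: field_simps)
    moreover have "d * d' + l \<noteq> 0" using False by simp
    ultimately have "d' = a * d" using nz(3) by simp
    then show ?thesis using nz by (simp add: field_simps)
  next
    \<comment> \<open>Here the \<open>e\<^sub>0\<close>-component gives no information on \<open>a\<close>, and timelikeness is what excludes \<open>cs - c = u\<close>.\<close>
    case True
    then have l: "l = - (d * d')" by simp
    have "(1 / d) *\<^sub>R (cs - c - u) = (a / d') *\<^sub>R (cs - c - u)"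
      using r1 nz unfolding cs' c' l by (simp add: vec_eq_iff field_simps)
    then have "(1 / d - a / d') *\<^sub>R (cs - c - u) = 0" by (simp add: scaleR_left_diff_distrib)
    moreover have "cs - c - u \<noteq> 0" using nonneg timelike unfolding u_def[symmetric] by auto
    ultimately have "1 / d - a / d' = 0" by (metis scaleR_eq_0_iff)
    then show ?thesis using nz by (simp add: field_simps)
  qed
  have eq: "d * d' * (mink cs' cs' - (l / d')\<^sup>2 - (mink cs cs - (l / d)\<^sup>2)) =
      l * ((mink c' c' - d'\<^sup>2) - (mink c c - d\<^sup>2))"
  proof -
    \<comment> \<open>The four bracketed expressions become variables, so that clearing denominators
      treats them as atoms.\<close>
    have "d * d' * (M' - M) = l * (N' - N)"
      if "- (d' / l * M') - N / d = d' / d * (- (d / l * M) - N' / d')" for M M' N N'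
    proof -
      have "l * d * (- (d' / l * M') - N / d) = l * d * (d' / d * (- (d / l * M) - N' / d'))"
        unfolding that ..
      then show ?thesis using nz by (simp add: right_diff_distrib mult.assoc)
    qed
    from this[OF r2[unfolded a]] show ?thesis .
  qed
  have "2 * mink u cs + l / (d * d') * mink u u - l * d * d' * (1 / d'\<^sup>2 - 1 / d\<^sup>2) =
      2 * mink u c + mink u u - d'\<^sup>2 + d\<^sup>2"
  proof -
    have "d * d' * (mink cs' cs' - (l / d')\<^sup>2 - (mink cs cs - (l / d)\<^sup>2)) =
        l * (2 * mink u cs + l / (d * d') * mink u u - l * d * d' * (1 / d'\<^sup>2 - 1 / d\<^sup>2))"
      using nz unfolding cs' by (simp add: mink_commute[of cs u] algebra_simps power2_eq_square)
    moreover have "mink c' c' - d'\<^sup>2 - (mink c c - d\<^sup>2) = 2 * mink u c + mink u u - d'\<^sup>2 + d\<^sup>2"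
      unfolding c' by (simp add: mink_commute[of c u])
    ultimately show ?thesis using eq nz(3) by simp
  qed
  moreover have "l * d * d' * (1 / d'\<^sup>2 - 1 / d\<^sup>2) = l / (d * d') * (d\<^sup>2 - d'\<^sup>2)"
    using nz by (simp add: field_simps power2_eq_square)
  moreover have "mink u ((cs' - c') + (cs - c)) =
      2 * mink u cs + l / (d * d') * mink u u - (2 * mink u c + mink u u)"
    unfolding mink_bilinear cs' c' by simp
  ultimately show ?thesis
    unfolding u_def[symmetric] by (simp only: distrib_left) (simp add: algebra_simps)
qed

section \<open>Lines tangent to a sphere centered at the origin\<close>

lemma line_touches_sphere_origin:
  assumes "x \<noteq> y" "y - x = r *\<^sub>R u" "mink u u > 0" "q = mink x x - (mink x u)\<^sup>2 / mink u u"
  shows "line_touches_sphere (line_through x y) 0 q"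
proof -
  define m where "m = mink x u / mink u u"
  \<comment> \<open>The foot of the perpendicular from the origin to the line. Its position vector
    is orthogonal to the line, so the sphere about the origin through it is touched there, and its
    squared norm is \<open>q\<close>.\<close>
  define z where "z = x - m *\<^sub>R u"
  have r: "r \<noteq> 0" using assms by auto
  have u: "u = (1 / r) *\<^sub>R (y - x)" using assms r by simp
  have zu: "mink z u = 0" using assms(3) by (simp add: z_def m_def)
  have "mink z z = q"
    using assms(3,4) by (simp add: z_def m_def mink_commute[of u x] power2_eq_square)
  moreover have "z \<in> line_through x y"
    unfolding line_through_def affine_hull_2
    \<comment> \<open>Affine coordinates of \<open>z\<close>, read off from u = (y - x) / r.\<close>
    by (rule CollectI, rule exI[of _ "1 + m / r"], rule exI[of _ "- m / r"])
      (simp add: z_def u algebra_simps)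
  moreover have "mink z (w - z) = 0" if w_line: "w \<in> line_through x y" for w
  proof -
    obtain \<alpha> \<beta> where w: "w = \<alpha> *\<^sub>R x + \<beta> *\<^sub>R y" "\<alpha> + \<beta> = 1"
      using w_line unfolding line_through_def affine_hull_2 by blast
    have "w = x + (\<beta> * r) *\<^sub>R u"
    proof -
      have "w = x + \<beta> *\<^sub>R (y - x)" using w by (simp add: algebra_simps flip: scaleR_left_distrib)
      then show ?thesis using assms(2) by simp
    qed
    then have "w - z = (\<beta> * r + m) *\<^sub>R u" by (simp add: z_def algebra_simps)
    then show ?thesis using zu by simp
  qed
  ultimately show ?thesis
    unfolding line_touches_sphere_def mink_sphere_def tangent_plane_def by auto
qed

lemma line_touches_sphere_scale:
  assumes "line_touches_sphere (line_through x y) 0 q"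
  shows "line_touches_sphere (line_through (\<mu> *\<^sub>R x) (\<mu> *\<^sub>R y)) 0 (\<mu>\<^sup>2 * q)"
proof -
  obtain z where z: "z \<in> line_through x y" "mink z z = q"
    "\<And>w. w \<in> line_through x y \<Longrightarrow> mink z (w - z) = 0"
    using assms unfolding line_touches_sphere_def mink_sphere_def tangent_plane_def by auto
  have "line_through (\<mu> *\<^sub>R x) (\<mu> *\<^sub>R y) = (*\<^sub>R) \<mu> ` line_through x y"
    unfolding line_through_def using affine_hull_linear_image[OF bounded_linear_scaleR_right, of \<mu> "{x, y}"]
    by simp
  with z show ?thesis
    unfolding line_touches_sphere_def mink_sphere_def tangent_plane_def
    by (intro bexI[of _ "\<mu> *\<^sub>R z"]) (auto simp: power2_eq_square)
qed

text \<open>The two conditions on n' determine the product of n and u as (d + d') (d - l/d).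
  Division by the length of u removes d', and the projection term becomes (d - l/d)^2, whose mixed
  term is the 2 l.\<close>

lemma horizontal_line_distance:
  assumes "d \<noteq> 0" "d' \<noteq> 0" "mink u u = (d + d')\<^sup>2" "mink u u > 0"
    and "n' = n + (l / (d * d') - 1) *\<^sub>R u"
    and "mink u (n' + n) = (d\<^sup>2 - d'\<^sup>2) * (1 + l / (d * d'))"
  shows "mink n n - (mink n u)\<^sup>2 / mink u u = mink n n - d\<^sup>2 - l\<^sup>2 / d\<^sup>2 + 2 * l"
proof -
  have "mink u n' + mink u n = (d\<^sup>2 - d'\<^sup>2) * (1 + l / (d * d'))"
    using assms(6) by simp
  then have "2 * mink n u = (d\<^sup>2 - d'\<^sup>2) * (1 + l / (d * d')) - (l / (d * d') - 1) * (d + d')\<^sup>2"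
    using assms(3,5) by (simp add: mink_commute)
  also have "\<dots> = 2 * ((d + d') * (d - l / d))"
    using assms(1,2) by (simp add: field_simps power2_eq_square)
  finally have "mink n u = (d + d') * (d - l / d)" by simp
  then have "(mink n u)\<^sup>2 / mink u u = (d - l / d)\<^sup>2"
    using assms(3,4) by (simp add: power_mult_distrib)
  then show ?thesis using assms(1) by (simp add: power2_diff power_divide)
qed

text \<open>Changing the signs of d' and l together keeps l/(d d') and exchanges the sum and the
  difference of the radii, which reduces this to the horizontal case.\<close>

lemma vertical_line_distance:
  assumes "d \<noteq> 0" "d' \<noteq> 0" "mink u u = (d - d')\<^sup>2" "mink u u > 0"
    and "n' = n + (l / (d * d') - 1) *\<^sub>R u"
    and "mink u (n' + n) = (d\<^sup>2 - d'\<^sup>2) * (1 + l / (d * d'))"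
  shows "mink n n - (mink n u)\<^sup>2 / mink u u = mink n n - d\<^sup>2 - l\<^sup>2 / d\<^sup>2 - 2 * l"
  using horizontal_line_distance[of d "- d'" u n' n "- l"] assms by simp

text \<open>The increment of the squared norm is the product of n' - n and n' + n. As n' - n is a
  multiple of u, it equals (l^2/(d d')^2 - 1) (d^2 - d'^2), which splits into a term at each end of
  the edge.\<close>

lemma mink_gauss_diff:
  assumes "d \<noteq> 0" "d' \<noteq> 0" "n' = n + (l / (d * d') - 1) *\<^sub>R u"
    and "mink u (n' + n) = (d\<^sup>2 - d'\<^sup>2) * (1 + l / (d * d'))"
  shows "mink n' n' - d'\<^sup>2 - l\<^sup>2 / d'\<^sup>2 = mink n n - d\<^sup>2 - l\<^sup>2 / d\<^sup>2"
proof -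
  have "mink n' n' - mink n n = mink (n' - n) (n' + n)" by (simp add: mink_commute)
  also have "\<dots> = (l / (d * d') - 1) * ((d\<^sup>2 - d'\<^sup>2) * (1 + l / (d * d')))"
    unfolding assms(4)[symmetric] using assms(3) by (metis add_diff_cancel_left' mink_bilinear(5))
  also have "\<dots> = d'\<^sup>2 + l\<^sup>2 / d'\<^sup>2 - (d\<^sup>2 + l\<^sup>2 / d\<^sup>2)"
    using assms(1,2) by (simp add: field_simps power2_eq_square)
  finally show ?thesis by simp
qed

section \<open>Quadrilaterals\<close>

text \<open>Gram-Schmidt applied to a basis of the two-dimensional direction space, on which
  \<open>mink\<close> is positive definite.\<close>

lemma spacelike_plane_frame:
  assumes "spacelike_plane A"
  obtains u w where "mink u u = 1" "mink w w = 1" "mink u w = 0"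
    "\<And>x y. x \<in> A \<Longrightarrow> y \<in> A \<Longrightarrow> x - y \<in> span {u, w}"
proof -
  have A: "affine A" "aff_dim A = 2"
    and pos: "\<And>x y. x \<in> A \<Longrightarrow> y \<in> A \<Longrightarrow> x \<noteq> y \<Longrightarrow> mink (y - x) (y - x) > 0"
    using assms unfolding spacelike_plane_def by auto
  obtain a where a: "a \<in> A" using A(2) by fastforce
  define S where "S = (\<lambda>x. x - a) ` A"
  have S: "subspace S" unfolding S_def using affine_diffs_subspace_subtract[OF A(1) a] .
  have "dim S = 2" using aff_dim_eq_dim_subtract[of a A] A(2) a by (simp add: S_def hull_inc)
  then obtain B where B: "B \<subseteq> S" "independent B" "S \<subseteq> span B" "card B = 2"
    by (metis basis_exists)
  then obtain b1 b2 where b: "B = {b1, b2}" "b1 \<noteq> b2" by (auto simp: card_2_iff)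
  have Spos: "mink x x > 0" if "x \<in> S" "x \<noteq> 0" for x
    using that pos[OF a] unfolding S_def by auto
  have "b1 \<noteq> 0" using B(2) b by (metis dependent_zero insertI1)
  then have b1: "mink b1 b1 > 0" using Spos B(1) b by auto
  define u where "u = (1 / sqrt (mink b1 b1)) *\<^sub>R b1"
  have uu: "mink u u = 1" using b1 by (simp add: u_def)
  have b1u: "b1 = sqrt (mink b1 b1) *\<^sub>R u" using b1 by (simp add: u_def)
  define w0 where "w0 = b2 - mink u b2 *\<^sub>R u"
  have w0S: "w0 \<in> S"
    using S B(1) b by (auto simp: w0_def u_def intro!: subspace_diff subspace_scale)
  have "w0 \<noteq> 0"
  proof
    assume "w0 = 0"
    then have "b2 \<in> span {b1}"
      by (metis w0_def u_def eq_iff_diff_eq_0 span_base insertI1 span_scale)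
    then have "dependent B" using b by (metis dependent_def insert_commute Diff_insert_absorb insert_iff singletonD)
    with B(2) show False by simp
  qed
  with w0S Spos have w0: "mink w0 w0 > 0" by blast
  define w where "w = (1 / sqrt (mink w0 w0)) *\<^sub>R w0"
  have ww: "mink w w = 1" using w0 by (simp add: w_def)
  have uw: "mink u w = 0" unfolding w_def w0_def using uu by simp
  have w0w: "w0 = sqrt (mink w0 w0) *\<^sub>R w" using w0 by (simp add: w_def)
  have "b1 \<in> span {u, w}" by (subst b1u) (simp add: span_base span_scale)
  moreover have "b2 \<in> span {u, w}"
  proof -
    have "b2 = sqrt (mink w0 w0) *\<^sub>R w + mink u b2 *\<^sub>R u" using w0w[symmetric] unfolding w0_def by simp
    also have "\<dots> \<in> span {u, w}" by (intro span_add span_scale span_base) auto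
    finally show ?thesis .
  qed
  ultimately have "span B \<subseteq> span {u, w}" using b by (simp add: span_minimal)
  with B(3) have sub: "S \<subseteq> span {u, w}" by simp
  show ?thesis
  proof (rule that[OF uu ww uw])
    fix x y assume "x \<in> A" "y \<in> A"
    then have "(x - a) - (y - a) \<in> span {u, w}"
      using sub unfolding S_def by (intro span_diff[of "x - a" _ "y - a"]) blast+
    then show "x - y \<in> span {u, w}" by simp
  qed
qed

text \<open>The oriented area is half the determinant of the diagonals, hence a quadratic form in
  them. Everything about areas below is computed from diagonals only.\<close>

lemma quad_area_diagonals:
  "quad_area u w P = (1/2) *
    (mink u (P 2 - P 0) * mink w (P 3 - P 1) - mink u (P 3 - P 1) * mink w (P 2 - P 0))"
proof -
  have "{..<4::nat} = {0, 1, 2, 3}" by auto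
  then show ?thesis
    by (simp add: quad_area_def algebra_simps flip: numeral_2_eq_2 numeral_3_eq_3)
qed

text \<open>The mixed area of P and R is a sum of two determinants, each pairing a diagonal of P
  with a parallel diagonal of R, so it vanishes. By bilinearity the mixed area of P and R - P is
  minus the area of P.\<close>

lemma quad_mean_curvature_opposite_diagonals:
  assumes "R 2 - R 0 = \<alpha> *\<^sub>R (P 3 - P 1)" "R 3 - R 1 = \<beta> *\<^sub>R (P 2 - P 0)"
    and "quad_area u w P \<noteq> 0"
  shows "quad_mean_curvature u w P (\<lambda>k. R k - P k) = 1"
proof -
  have R: "R 2 = R 0 + \<alpha> *\<^sub>R (P 3 - P 1)" "R 3 = R 1 + \<beta> *\<^sub>R (P 2 - P 0)"
    using assms(1,2) by (simp_all add: algebra_simps)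
  have "mixed_area u w P (\<lambda>k. R k - P k) = - quad_area u w P"
    unfolding mixed_area_def quad_area_diagonals by (simp add: R algebra_simps)
  then show ?thesis using assms(3) by (simp add: quad_mean_curvature_def)
qed

text \<open>Each dual diagonal is the sum of two dual edges; the \<open>e_zero\<close> and Minkowski
  components of the face relation turn that sum into a multiple of the other diagonal. The second
  claim keeps the factor \<open>a\<close>, which may be zero; the third says that the face then
  collapses.\<close>

lemma christoffel_dual_diagonals:
  fixes c c' :: "nat \<Rightarrow> real ^ 3" and d :: "nat \<Rightarrow> real"
  assumes nz: "d 0 \<noteq> 0" "d 1 \<noteq> 0" "d 2 \<noteq> 0" "d 3 \<noteq> 0"
    and dual: "c' 1 - c' 0 = (l / (d 0 * d 1)) *\<^sub>R (c 1 - c 0)"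
      "c' 2 - c' 1 = (l / (d 1 * d 2)) *\<^sub>R (c 2 - c 1)"
      "c' 3 - c' 0 = (l / (d 0 * d 3)) *\<^sub>R (c 3 - c 0)"
    and lift: "lift (c 2, d 2) - lift (c 0, d 0) = a *\<^sub>R (lift (c 3, d 3) - lift (c 1, d 1))"
  shows "c' 2 - c' 0 = (l * a / (d 1 * d 3)) *\<^sub>R (c 3 - c 1)"
    and "a *\<^sub>R (c' 3 - c' 1) = (l / (d 0 * d 2)) *\<^sub>R (c 2 - c 0)"
    and "a = 0 \<Longrightarrow> c 2 = c 0"
proof -
  define e where "e k = 1 / d k" for k
  have E: "e 2 - e 0 = a * (e 3 - e 1)"
    and C: "e 2 *\<^sub>R c 2 - e 0 *\<^sub>R c 0 = a *\<^sub>R (e 3 *\<^sub>R c 3 - e 1 *\<^sub>R c 1)"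
    using lift_diff_proportional[OF lift] by (simp_all add: e_def)
  have "c' 2 - c' 0 = (c' 2 - c' 1) + (c' 1 - c' 0)" by simp
  also have "\<dots> = (l * e 1) *\<^sub>R ((e 2 *\<^sub>R c 2 - e 0 *\<^sub>R c 0) - (e 2 - e 0) *\<^sub>R c 1)"
    unfolding dual e_def by (simp add: vec_eq_iff algebra_simps)
  also have "\<dots> = (l * a / (d 1 * d 3)) *\<^sub>R (c 3 - c 1)"
    unfolding C E by (simp add: vec_eq_iff algebra_simps e_def)
  finally show "c' 2 - c' 0 = (l * a / (d 1 * d 3)) *\<^sub>R (c 3 - c 1)" .
  have "a *\<^sub>R (c' 3 - c' 1) = a *\<^sub>R ((c' 3 - c' 0) - (c' 1 - c' 0))" by simp
  also have "\<dots> = (l * e 0) *\<^sub>R (a *\<^sub>R (e 3 *\<^sub>R c 3 - e 1 *\<^sub>R c 1) - (a * (e 3 - e 1)) *\<^sub>R c 0)"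
    unfolding dual e_def by (simp add: vec_eq_iff algebra_simps)
  also have "\<dots> = (l / (d 0 * d 2)) *\<^sub>R (c 2 - c 0)"
    unfolding C[symmetric] E[symmetric] by (simp add: vec_eq_iff algebra_simps e_def)
  finally show "a *\<^sub>R (c' 3 - c' 1) = (l / (d 0 * d 2)) *\<^sub>R (c 2 - c 0)" .
  show "c 2 = c 0" if "a = 0"
    using C E nz that by (simp add: e_def)
qed

section \<open>The cmc pair\<close>

lemma quad_frame_scale:
  assumes "quad_frame P u w"
  shows "quad_frame (\<lambda>k. \<mu> *\<^sub>R P k) u w"
  using assms unfolding quad_frame_def by (simp add: span_scale flip: scaleR_diff_right)

section \<open>Incidences in the quad graph and edge vectors\<close>

lemma quad_graph_face:
  assumes "quad_graph G" "f \<in> faces G" "k < 4"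
  shows "corner G f k \<in> verts G" "adjacent G (corner G f k) (corner G f ((k + 1) mod 4))"
proof -
  have "corner G f k \<in> verts G \<and> side G f k \<in> edges G \<and>
      ends G (side G f k) = {corner G f k, corner G f ((k + 1) mod 4)}"
    using assms unfolding quad_graph_def by (elim conjE) simp
  then show "corner G f k \<in> verts G" "adjacent G (corner G f k) (corner G f ((k + 1) mod 4))"
    unfolding adjacent_def by blast+
qed

lemma adjacent_commute: "adjacent G v w \<longleftrightarrow> adjacent G w v"
  by (simp add: adjacent_def insert_commute)

text \<open>Spacelike planes are attached to faces, so statements on edges need a bordering face.
  One exists because \<open>face_sides_at\<close> has one or two elements.\<close>

lemma adjacent_in_face:
  assumes "quad_graph G" "adjacent G v w"
  obtains f k where "f \<in> faces G" "k < 4" "{v, w} = {corner G f k, corner G f ((k + 1) mod 4)}"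
proof -
  obtain e where e: "e \<in> edges G" "ends G e = {v, w}" using assms(2) by (auto simp: adjacent_def)
  have "card (face_sides_at G e) \<in> {1, 2}" using assms(1) e(1) unfolding quad_graph_def by blast
  then have "face_sides_at G e \<noteq> {}" by auto
  then obtain f k where fk: "f \<in> faces G" "k < 4" "side G f k = e"
    by (auto simp: face_sides_at_def)
  then have "ends G e = {corner G f k, corner G f ((k + 1) mod 4)}"
    using assms(1) unfolding quad_graph_def by blast
  with e(2) fk that show ?thesis by metis
qed

lemma adjacent_iff: "adjacent G v w \<longleftrightarrow> hor_adjacent G v w \<or> ver_adjacent G v w"
  by (auto simp: adjacent_def hor_adjacent_def ver_adjacent_def)

lemma adjacent_verts:
  assumes "quad_graph G" "adjacent G v w"
  shows "v \<in> verts G" "w \<in> verts G"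
proof -
  obtain e where e: "e \<in> edges G" "ends G e = {v, w}" using assms(2) by (auto simp: adjacent_def)
  moreover have "ends G e \<subseteq> verts G" using assms(1) e(1) unfolding quad_graph_def by blast
  ultimately show "v \<in> verts G" "w \<in> verts G" by auto
qed

lemma S_isothermic_edge_spacelike:
  assumes "quad_graph G" "S_isothermic G s" "adjacent G v w" "center (s v) \<noteq> center (s w)"
  shows "mink (center (s w) - center (s v)) (center (s w) - center (s v)) > 0"
proof -
  obtain f k where f: "f \<in> faces G" "k < 4" "{v, w} = {corner G f k, corner G f ((k + 1) mod 4)}"
    using adjacent_in_face[OF assms(1,3)] .
  then obtain A where A: "spacelike_plane A" "\<forall>k < 4. center (s (corner G f k)) \<in> A"
    using assms(2) unfolding S_isothermic_def by blast
  have "\<exists>j < 4. v = corner G f j" "\<exists>j < 4. w = corner G f j"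
    using f by (auto simp: doubleton_eq_iff intro: exI[of _ "(k + 1) mod 4"])
  with A(2) have "center (s v) \<in> A" "center (s w) \<in> A" by auto
  with A(1) assms(4) show ?thesis unfolding spacelike_plane_def by blast
qed

lemma S1_isothermic_edge_length:
  assumes "quad_graph G" "S1_isothermic G s"
  defines "u \<equiv> \<lambda>v w. center (s w) - center (s v)"
  shows "hor_adjacent G v w \<Longrightarrow> mink (u v w) (u v w) = (radius (s v) + radius (s w))\<^sup>2"
    and "ver_adjacent G v w \<Longrightarrow> mink (u v w) (u v w) = (radius (s v) - radius (s w))\<^sup>2"
proof -
  have nz: "radius (s v) \<noteq> 0" "radius (s w) \<noteq> 0" if "adjacent G v w"
    using adjacent_verts[OF assms(1) that] assms(2) unfolding S1_isothermic_def S_isothermic_def by auto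
  have inn: "inner32 (lift (s v)) (lift (s w)) =
      ((radius (s v))\<^sup>2 + (radius (s w))\<^sup>2 - mink (u v w) (u v w)) / (2 * radius (s v) * radius (s w))"
    if "adjacent G v w"
    using inner32_lift[OF nz[OF that], of "center (s v)" "center (s w)"] by (simp add: u_def)
  show "mink (u v w) (u v w) = (radius (s v) + radius (s w))\<^sup>2" if h: "hor_adjacent G v w"
  proof -
    have adj: "adjacent G v w" using h by (simp add: adjacent_iff)
    have "inner32 (lift (s v)) (lift (s w)) = - 1" using h assms(2) by (simp add: S1_isothermic_def)
    then show ?thesis using inn[OF adj] nz[OF adj] by (simp add: field_simps power2_eq_square)
  qed
  show "mink (u v w) (u v w) = (radius (s v) - radius (s w))\<^sup>2" if h: "ver_adjacent G v w"
  proof -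
    have adj: "adjacent G v w" using h by (simp add: adjacent_iff)
    have "inner32 (lift (s v)) (lift (s w)) = 1" using h assms(2) by (simp add: S1_isothermic_def)
    then show ?thesis using inn[OF adj] nz[OF adj] by (simp add: field_simps power2_eq_square)
  qed
qed

text \<open>Centers and Gauss map scale together, so the factor \<open>\<mu>\<close> is arbitrary.
  On each face the dual quadrilateral has the opposite diagonals required for curvature 1.\<close>

lemma cmc_constant_mean_curvature:
  assumes G: "quad_graph G" and cmc: "S1_cmc_pair G s s'"
  shows "constant_mean_curvature G (scale_sphere \<mu> \<circ> s)
    (gauss_map (scale_sphere \<mu> \<circ> s) (scale_sphere \<mu> \<circ> s')) 1"
proof -
  have iso: "S_isothermic G s" and chr: "christoffel_dual G s s'"
    using cmc by (auto simp: S1_cmc_pair_def S1_isothermic_def)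
  obtain l where dual: "\<And>v w. adjacent G v w \<Longrightarrow> center (s' w) - center (s' v) =
      (l / (radius (s v) * radius (s w))) *\<^sub>R (center (s w) - center (s v))"
    using chr unfolding christoffel_dual_def by blast
  show ?thesis
    unfolding constant_mean_curvature_def Let_def
  proof (intro ballI conjI allI impI)
    fix f assume f: "f \<in> faces G"
    define v where "v = corner G f"
    define c where "c k = center (s (v k))" for k
    define c' where "c' k = center (s' (v k))" for k
    define d where "d k = radius (s (v k))" for k
    let ?P = "\<lambda>k. center ((scale_sphere \<mu> \<circ> s) (corner G f k))"
    let ?Q = "\<lambda>k. gauss_map (scale_sphere \<mu> \<circ> s) (scale_sphere \<mu> \<circ> s') (corner G f k)"
    have P: "?P = (\<lambda>k. \<mu> *\<^sub>R c k)" by (simp add: scale_sphere_def c_def v_def)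
    have Q: "?Q = (\<lambda>k. \<mu> *\<^sub>R c' k - \<mu> *\<^sub>R c k)"
      by (simp add: gauss_map_def scale_sphere_def c_def c'_def v_def)
    have adj: "adjacent G (v k) (v ((k + 1) mod 4))" if "k < 4" for k
      unfolding v_def by (rule quad_graph_face(2)[OF G f that])
    have edge: "c' ((k + 1) mod 4) - c' k =
        (l / (d k * d ((k + 1) mod 4))) *\<^sub>R (c ((k + 1) mod 4) - c k)" if "k < 4" for k
      unfolding c_def c'_def d_def by (rule dual[OF adj[OF that]])
    show "parallel_edges ?P ?Q"
      unfolding parallel_edges_def P Q
    proof (intro allI impI)
      fix k :: nat assume k: "k < 4"
      let ?k = "(k + 1) mod 4"
      have "\<mu> *\<^sub>R c' ?k - \<mu> *\<^sub>R c ?k - (\<mu> *\<^sub>R c' k - \<mu> *\<^sub>R c k) =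
          \<mu> *\<^sub>R (c' ?k - c' k) - \<mu> *\<^sub>R (c ?k - c k)" by (simp add: algebra_simps)
      also have "\<dots> = (l / (d k * d ?k) - 1) *\<^sub>R (\<mu> *\<^sub>R c ?k - \<mu> *\<^sub>R c k)"
        unfolding edge[OF k] by (simp add: algebra_simps)
      finally show "\<mu> *\<^sub>R c' ?k - \<mu> *\<^sub>R c ?k - (\<mu> *\<^sub>R c' k - \<mu> *\<^sub>R c k)
          \<in> span {\<mu> *\<^sub>R c ?k - \<mu> *\<^sub>R c k}"
        by (simp add: span_base span_scale)
    qed
    obtain A where A: "spacelike_plane A" "\<forall>k < 4. c k \<in> A"
      using iso f unfolding S_isothermic_def c_def v_def by blast
    obtain u w where "quad_frame c u w"
      using spacelike_plane_frame[OF A(1)] A(2) unfolding quad_frame_def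
      by (metis zero_less_numeral)
    then show "\<exists>u w. quad_frame ?P u w" unfolding P using quad_frame_scale by blast
    fix u w assume "quad_frame ?P u w \<and> quad_area u w ?P \<noteq> 0"
    then have area: "quad_area u w (\<lambda>k. \<mu> *\<^sub>R c k) \<noteq> 0" unfolding P by simp
    obtain a where a: "lift (s (v 2)) - lift (s (v 0)) = a *\<^sub>R (lift (s (v 3)) - lift (s (v 1)))"
      using iso f unfolding S_isothermic_def v_def by blast
    have nz: "d k \<noteq> 0" if "k < 4" for k
      using iso quad_graph_face(1)[OF G f that] unfolding S_isothermic_def d_def v_def by blast
    \<comment> \<open>Side 3 runs from corner 3 back to corner 0, so it is traversed in reverse
      here.\<close>
    have e30: "c' 3 - c' 0 = (l / (d 0 * d 3)) *\<^sub>R (c 3 - c 0)"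
      using dual[of "v 0" "v 3"] adj[of 3] adjacent_commute[of G "v 0"] by (simp add: c_def c'_def d_def)
    have "lift (c 2, d 2) - lift (c 0, d 0) = a *\<^sub>R (lift (c 3, d 3) - lift (c 1, d 1))"
      using a by (simp add: c_def d_def)
    note diag = christoffel_dual_diagonals[of d c' l c a, OF nz nz nz nz _ _ e30 this]
    have diag1: "c' 2 - c' 0 = (l * a / (d 1 * d 3)) *\<^sub>R (c 3 - c 1)"
      and diag2: "a *\<^sub>R (c' 3 - c' 1) = (l / (d 0 * d 2)) *\<^sub>R (c 2 - c 0)"
      and diag0: "a = 0 \<Longrightarrow> c 2 = c 0"
      using diag edge[of 0] edge[of 1] by (simp_all add: numeral_2_eq_2)
    \<comment> \<open>For \<open>a = 0\<close> the diagonal from corner 0 to corner 2 would be zero,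
      and with it the area.\<close>
    have "a \<noteq> 0" using area diag0 by (auto simp: quad_area_diagonals)
    then have diag3: "c' 3 - c' 1 = (l / (a * d 0 * d 2)) *\<^sub>R (c 2 - c 0)"
      using arg_cong[OF diag2, of "(*\<^sub>R) (1 / a)"] by simp
    show "quad_mean_curvature u w ?P ?Q = 1"
      unfolding P Q
    proof (rule quad_mean_curvature_opposite_diagonals[OF _ _ area])
      show "\<mu> *\<^sub>R c' 2 - \<mu> *\<^sub>R c' 0 = (l * a / (d 1 * d 3)) *\<^sub>R (\<mu> *\<^sub>R c 3 - \<mu> *\<^sub>R c 1)"
        by (metis diag1 scaleR_diff_right scaleR_left_commute)
      show "\<mu> *\<^sub>R c' 3 - \<mu> *\<^sub>R c' 1 = (l / (a * d 0 * d 2)) *\<^sub>R (\<mu> *\<^sub>R c 2 - \<mu> *\<^sub>R c 0)"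
        by (metis diag3 scaleR_diff_right scaleR_left_commute)
    qed
  qed
qed

section \<open>The Gauss map as a two-sphere Koebe net\<close>

lemma gauss_map_scale:
  "gauss_map (scale_sphere \<mu> \<circ> s) (scale_sphere \<mu> \<circ> s') = (\<lambda>v. \<mu> *\<^sub>R gauss_map s s' v)"
  by (auto simp: gauss_map_def scale_sphere_def algebra_simps)

text \<open>All edges of Q inherit the direction plane of P, and walking around from corner 0
  reaches every corner. This gives planar faces of the Gauss map as a consequence of parallel
  edges.\<close>

lemma coplanar_parallel_quad:
  assumes "quad_frame P u w" "parallel_edges P Q"
  shows "coplanar (Q ` {..<4})"
proof -
  have P: "P k - P 0 \<in> span {u, w}" if "k < 4" for k using assms(1) that by (simp add: quad_frame_def)
  have edge: "Q ((k + 1) mod 4) - Q k \<in> span {u, w}" if k: "k < 4" for k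
  proof -
    have "P ((k + 1) mod 4) - P k = (P ((k + 1) mod 4) - P 0) - (P k - P 0)" by simp
    also have "\<dots> \<in> span {u, w}" using k by (intro span_diff P) auto
    finally have "span {P ((k + 1) mod 4) - P k} \<subseteq> span {u, w}" by (simp add: span_minimal)
    with assms(2) k show ?thesis unfolding parallel_edges_def by blast
  qed
  have "Q k - Q 0 \<in> span {u, w}" if "k < 4" for k
    using that
  proof (induction k)
    case (Suc k)
    then have "(Q (Suc k) - Q k) + (Q k - Q 0) \<in> span {u, w}"
      using edge[of k] by (intro span_add) auto
    then show ?case by simp
  qed (simp add: span_zero)
  then have "Q ` {..<4} \<subseteq> affine hull {Q 0, Q 0 + u, Q 0 + w}"
    by (force simp: affine_hull_insert_span_gen[of "Q 0"] image_iff)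
  then show ?thesis unfolding coplanar_def by blast
qed

lemma cmc_edge_inner:
  assumes G: "quad_graph G" and cmc: "S1_cmc_pair G s s'"
    and distinct: "neighbours_distinct G (gauss_map s s')"
  defines "n \<equiv> gauss_map s s'" and "u \<equiv> \<lambda>v w. center (s w) - center (s v)"
    and "d \<equiv> \<lambda>v. radius (s v)"
  obtains l where "\<And>v. v \<in> verts G \<Longrightarrow> d v \<noteq> 0"
    and "\<And>v w. adjacent G v w \<Longrightarrow> n w = n v + (l / (d v * d w) - 1) *\<^sub>R u v w"
    and "\<And>v w. adjacent G v w \<Longrightarrow>
      mink (u v w) (n w + n v) = ((d v)\<^sup>2 - (d w)\<^sup>2) * (1 + l / (d v * d w))"
    and "\<And>v w. adjacent G v w \<Longrightarrow> mink (u v w) (u v w) > 0"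
proof -
  have iso: "S_isothermic G s" and chr: "christoffel_dual G s s'"
    and dar: "darboux_edges G s s' \<or> darboux_edges G s (reverse_orientation \<circ> s')"
    and tl: "\<And>v. v \<in> verts G \<Longrightarrow> mink (n v) (n v) < 0"
    using cmc unfolding S1_cmc_pair_def S1_isothermic_def timelike_darboux_pair_def
      timelike_def n_def gauss_map_def by auto
  obtain l where l: "l > 0" and rad: "\<And>v. v \<in> verts G \<Longrightarrow> radius (s' v) = l / d v"
    and dual: "\<And>v w. adjacent G v w \<Longrightarrow> center (s' w) - center (s' v) = (l / (d v * d w)) *\<^sub>R u v w"
    using chr unfolding christoffel_dual_def d_def u_def by blast
  have nz: "d v \<noteq> 0" if "v \<in> verts G" for v
    using iso that unfolding S_isothermic_def d_def by blast
  have step: "n w = n v + (l / (d v * d w) - 1) *\<^sub>R u v w" if "adjacent G v w" for v w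
  proof -
    have "n w = n v + (center (s' w) - center (s' v)) - u v w"
      by (simp add: n_def u_def gauss_map_def)
    then show ?thesis unfolding dual[OF that] by (simp add: algebra_simps)
  qed
  have pos: "mink (u v w) (u v w) > 0" if adj: "adjacent G v w" for v w
  proof -
    have "n v \<noteq> n w" using distinct adj by (simp add: neighbours_distinct_def n_def)
    \<comment> \<open>The difference of the Gauss map is a multiple of \<open>u v w\<close>, so
      distinct images need distinct centers.\<close>
    then have "center (s v) \<noteq> center (s w)" using step[OF adj] by (auto simp: u_def)
    then show ?thesis unfolding u_def using S_isothermic_edge_spacelike[OF G iso adj] by blast
  qed
  have lift_s: "lift (s v) = lift (center (s v), d v)" for v by (simp add: d_def)
  have lift_s': "lift (s' v) = lift (center (s' v), l / d v)" if "v \<in> verts G" for v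
    by (simp flip: rad[OF that])
  have inner: "mink (u v w) (n w + n v) = ((d v)\<^sup>2 - (d w)\<^sup>2) * (1 + l / (d v * d w))"
    if adj: "adjacent G v w" for v w
  \<comment> \<open>The orientation is reversed for all spheres at once or for none, so this single
    edge, on which the Gauss map is not constant, decides between the two alternatives.\<close>
  proof -
    note vw = adjacent_verts[OF G adj]
    note nzs = nz[OF vw(1)] nz[OF vw(2)] l
    note dual_vw = dual[OF adj, unfolded u_def]
    have "\<not> darboux_edges G s s'"
    proof
      assume "darboux_edges G s s'"
      then obtain a where "lift (s' w) - lift (s v) = a *\<^sub>R (lift (s' v) - lift (s w))"
        using adj unfolding darboux_edges_def by blast
      then have "n w = n v"
        unfolding lift_s lift_s'[OF vw(1)] lift_s'[OF vw(2)] n_def gauss_map_def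
        using darboux_edge_degenerate[OF nzs dual_vw] by blast
      then show False using distinct adj unfolding neighbours_distinct_def n_def by metis
    qed
    then have "darboux_edges G s (reverse_orientation \<circ> s')" using dar by blast
    then obtain a where "lift (reverse_orientation (s' w)) - lift (s v) =
        a *\<^sub>R (lift (reverse_orientation (s' v)) - lift (s w))"
      using adj unfolding darboux_edges_def comp_def by blast
    then have "lift (center (s' w), - (l / d w)) - lift (center (s v), d v) =
        a *\<^sub>R (lift (center (s' v), - (l / d v)) - lift (center (s w), d w))"
      by (simp add: reverse_orientation_def rad vw d_def)
    from darboux_edge_inner[OF nzs dual_vw this] show ?thesis
      using pos[OF adj] tl[OF vw(1)] unfolding u_def n_def gauss_map_def by simp
  qed
  show ?thesis using that[of l] nz step inner pos by blast
qed

lemma cmc_gauss_map_tangent: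
  assumes G: "quad_graph G" and cmc: "S1_cmc_pair G s s'"
    and distinct: "neighbours_distinct G (gauss_map s s')"
  defines "n \<equiv> gauss_map s s'"
  shows "\<exists>p<0. \<exists>q<0.
    (\<forall>v w. hor_adjacent G v w \<longrightarrow> line_touches_sphere (line_through (n v) (n w)) 0 p) \<and>
    (\<forall>v w. ver_adjacent G v w \<longrightarrow> line_touches_sphere (line_through (n v) (n w)) 0 q)"
proof -
  define u where "u v w = center (s w) - center (s v)" for v w
  define d where "d v = radius (s v)" for v
  obtain l where nz: "\<And>v. v \<in> verts G \<Longrightarrow> d v \<noteq> 0"
    and step: "\<And>v w. adjacent G v w \<Longrightarrow> n w = n v + (l / (d v * d w) - 1) *\<^sub>R u v w"
    and inner: "\<And>v w. adjacent G v w \<Longrightarrow>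
      mink (u v w) (n w + n v) = ((d v)\<^sup>2 - (d w)\<^sup>2) * (1 + l / (d v * d w))"
    and pos: "\<And>v w. adjacent G v w \<Longrightarrow> mink (u v w) (u v w) > 0"
    using cmc_edge_inner[OF G cmc distinct] unfolding n_def u_def d_def by metis
  have S1: "S1_isothermic G s" and tl: "\<And>v. v \<in> verts G \<Longrightarrow> mink (n v) (n v) < 0"
    using cmc unfolding S1_cmc_pair_def timelike_darboux_pair_def timelike_def n_def gauss_map_def
    by auto
  define \<kappa> where "\<kappa> v = mink (n v) (n v) - (d v)\<^sup>2 - l\<^sup>2 / (d v)\<^sup>2" for v
  have \<kappa>_adj: "\<kappa> w = \<kappa> v" if "adjacent G v w" for v w
    unfolding \<kappa>_def using mink_gauss_diff nz adjacent_verts[OF G that] step[OF that] inner[OF that]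
    by blast
  have "\<kappa> w = \<kappa> v" if "(adjacent G)\<^sup>*\<^sup>* v w" for v w
    using that by (induction rule: rtranclp_induct) (auto dest: \<kappa>_adj)
  then have conn: "\<kappa> v = \<kappa> w" if "v \<in> verts G" "w \<in> verts G" for v w
    using G that unfolding quad_graph_def by metis
  \<comment> \<open>The common value of \<open>\<kappa>\<close> on the connected graph; if there are
    no vertices, it is arbitrary and harmless.\<close>
  define K where "K = \<kappa> (SOME v. v \<in> verts G)"
  have K: "\<kappa> v = K" if "v \<in> verts G" for v
    unfolding K_def using conn[OF that] someI[of "\<lambda>v. v \<in> verts G", OF that] by blast
  have touch: "line_touches_sphere (line_through (n v) (n w)) 0 r \<and> r < 0"
    if adj: "adjacent G v w" and r: "mink (n v) (n v) - (mink (n v) (u v w))\<^sup>2 / mink (u v w) (u v w) = r"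
    for v w r
  proof
    have "n v \<noteq> n w" using distinct adj by (simp add: neighbours_distinct_def n_def)
    then show "line_touches_sphere (line_through (n v) (n w)) 0 r"
      using line_touches_sphere_origin[of "n v" "n w" _ "u v w" r] step[OF adj] pos[OF adj] r by force
    have "(mink (n v) (u v w))\<^sup>2 / mink (u v w) (u v w) \<ge> 0" using pos[OF adj] by simp
    then show "r < 0" using r tl[OF adjacent_verts(1)[OF G adj]] by linarith
  qed
  have hor: "line_touches_sphere (line_through (n v) (n w)) 0 (K + 2 * l) \<and> K + 2 * l < 0"
    if h: "hor_adjacent G v w" for v w
  proof -
    have adj: "adjacent G v w" using h by (simp add: adjacent_iff)
    note vw = adjacent_verts[OF G adj]
    have "mink (u v w) (u v w) = (d v + d w)\<^sup>2"
      unfolding u_def d_def by (rule S1_isothermic_edge_length(1)[OF G S1 h])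
    from horizontal_line_distance[OF nz[OF vw(1)] nz[OF vw(2)] this pos[OF adj] step[OF adj] inner[OF adj]]
    show ?thesis using K[OF vw(1)] by (intro touch[OF adj]) (simp add: \<kappa>_def)
  qed
  have ver: "line_touches_sphere (line_through (n v) (n w)) 0 (K - 2 * l) \<and> K - 2 * l < 0"
    if h: "ver_adjacent G v w" for v w
  proof -
    have adj: "adjacent G v w" using h by (simp add: adjacent_iff)
    note vw = adjacent_verts[OF G adj]
    have "mink (u v w) (u v w) = (d v - d w)\<^sup>2"
      unfolding u_def d_def by (rule S1_isothermic_edge_length(2)[OF G S1 h])
    from vertical_line_distance[OF nz[OF vw(1)] nz[OF vw(2)] this pos[OF adj] step[OF adj] inner[OF adj]]
    show ?thesis using K[OF vw(1)] by (intro touch[OF adj]) (simp add: \<kappa>_def)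
  qed
  \<comment> \<open>The sign of \<open>K + 2 * l\<close> is known only from an existing horizontal
    edge. Without one, -1 serves as the squared radius; likewise for vertical edges.\<close>
  have "\<exists>p<0. \<forall>v w. hor_adjacent G v w \<longrightarrow> line_touches_sphere (line_through (n v) (n w)) 0 p"
    using hor by (metis neg_less_0_iff_less zero_less_one)
  moreover have "\<exists>q<0. \<forall>v w. ver_adjacent G v w \<longrightarrow> line_touches_sphere (line_through (n v) (n w)) 0 q"
    using ver by (metis neg_less_0_iff_less zero_less_one)
  ultimately show ?thesis by blast
qed

text \<open>Curvature 1 holds at every scale, so only the normalization of the two spheres has to
  fix \<open>\<mu>\<close>.\<close>

theorem theorem10p4:
  fixes G :: "('v, 'e, 'f) quad_graph_data"
    and s s_star :: "'v \<Rightarrow> osphere"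
  assumes "quad_graph G"
    and "S1_cmc_pair G s s_star"
  shows "\<exists>\<mu> > 0.
    let t = scale_sphere \<mu> \<circ> s; t_star = scale_sphere \<mu> \<circ> s_star; n = gauss_map t t_star in
      (neighbours_distinct G n \<longrightarrow> spacelike_two_sphere_koebe G n) \<and>
      constant_mean_curvature G t n 1"
proof (cases "neighbours_distinct G (gauss_map s s_star)")
  \<comment> \<open>The scale 1 leaves the Gauss map unchanged, so the premise of the Koebe claim
    fails and only the curvature remains.\<close>
  case False
  have "gauss_map (scale_sphere 1 \<circ> s) (scale_sphere 1 \<circ> s_star) = gauss_map s s_star"
    by (simp add: gauss_map_scale)
  with False show ?thesis
    using cmc_constant_mean_curvature[OF assms, of 1] unfolding Let_def by (intro exI[of _ 1]) simp
next
  case True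
  let ?n = "gauss_map s s_star"
  obtain p q where pq: "p < 0" "q < 0"
    and hor: "\<And>v w. hor_adjacent G v w \<Longrightarrow> line_touches_sphere (line_through (?n v) (?n w)) 0 p"
    and ver: "\<And>v w. ver_adjacent G v w \<Longrightarrow> line_touches_sphere (line_through (?n v) (?n w)) 0 q"
    using cmc_gauss_map_tangent[OF assms True] by blast
  \<comment> \<open>Scaling by \<open>\<mu>\<close> multiplies both squared radii by
    \<open>\<mu>\<^sup>2\<close>, so the normalization demands a fourth root of 1/(p q).\<close>
  define \<mu> where "\<mu> = sqrt (sqrt (1 / (p * q)))"
  have "p * q > 0" using pq by (simp add: mult_neg_neg)
  then have \<mu>: "\<mu> > 0" by (simp add: \<mu>_def)
  have "(\<mu>\<^sup>2)\<^sup>2 = 1 / (p * q)" using \<open>p * q > 0\<close> by (simp add: \<mu>_def)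
  then have "(\<mu>\<^sup>2)\<^sup>2 * (p * q) = 1" using pq by simp
  then have prod: "(\<mu>\<^sup>2 * p) * (\<mu>\<^sup>2 * q) = 1" by (simp add: power2_eq_square ac_simps)
  let ?t = "scale_sphere \<mu> \<circ> s"
  let ?n' = "gauss_map ?t (scale_sphere \<mu> \<circ> s_star)"
  have H: "constant_mean_curvature G ?t ?n' 1" by (rule cmc_constant_mean_curvature[OF assms])
  have "coplanar (?n' ` corner G f ` {..<4})" if "f \<in> faces G" for f
    using H that coplanar_parallel_quad unfolding constant_mean_curvature_def Let_def image_image by blast
  then have "spacelike_two_sphere_koebe G ?n'" if "neighbours_distinct G ?n'"
    unfolding spacelike_two_sphere_koebe_def
    using that prod pq \<mu> line_touches_sphere_scale[OF hor, of _ _ \<mu>] line_touches_sphere_scale[OF ver, of _ _ \<mu>]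
    by (intro conjI exI[of _ "\<mu>\<^sup>2 * p"] exI[of _ "\<mu>\<^sup>2 * q"])
      (auto simp: gauss_map_scale mult_pos_neg)
  with H \<mu> show ?thesis unfolding Let_def by blast
qed

end
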